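(* Let $X, X_1, X_2, \ldots$ be an arbitrary stationary and square integrable sequence of real-valued random variables defined on a probability space $(\Omega,\mathcal{A},\mathbb{P})$, with common cumulative distribution function $F$. Suppose that for some $\delta\in(0,3)$ the following two conditions hold for every $x\in\mathbb{R}$: $$\sup_{q\geq 1}\frac{1}{q^{(3-\delta)/2}}\left[\sum_{i=1}^{q}\mathrm{Var}\left(\mathbb{I}_{\{X_i\leq x\}}\right)+\sum_{\substack{1\leq i,j\leq q\\ i\neq j}}\mathrm{Cov}\left(\mathbb{I}_{\{X_i\leq x\}},\mathbb{I}_{\{X_j\leq x\}}\right)\right]<+\infty$$ and $$\sup_{q\geq 1}\frac{1}{q^{3-\delta}}\left[\sum_{i=q^2+1}^{(q+1)^2}\mathrm{Var}\left(\mathbb{I}_{\{X_i\leq x\}}\right)+\sum_{\substack{q^2+1\leq i,j\leq (q+1)^2\\ i\neq j}}\mathrm{Cov}\left(\mathbb{I}_{\{X_i\leq x\}},\mathbb{I}_{\{X_j\leq x\}}\right)\right]<+\infty,$$ where $q$ ranges over the positive integers. Then $$\sup_{x\in\mathbb{R}}|F_n(x)-F(x)|\rightarrow 0\quad\text{almost surely, as } n\rightarrow+\infty.$$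
   Context: For $n\ge 1$ the empirical function is $F_n(x)=\frac{1}{n}\sum_{i=1}^{n}\mathbb{I}_{\{X_i\leq x\}}$, $x\in\mathbb{R}$, where $\mathbb{I}_{\{X_i\le x\}}$ is the indicator of the event $\{X_i\leq x\}$, and $F(x)=\mathbb{E}(\mathbb{I}_{\{X_i\leq x\}})=\mathbb{P}(X\leq x)$ is the common cumulative distribution function. Square integrable means $\mathbb{E}X_i^2<+\infty$. *)

theory Defs
  imports "HOL-Probability.Probability"
begin

text \<open>Sequences are indexed by the positive integers; the value at index \<open>0\<close> is never used.\<close>

definition indic_le :: "('a \<Rightarrow> real) \<Rightarrow> real \<Rightarrow> 'a \<Rightarrow> real" where
  "indic_le Y x \<omega> = indicator {\<omega>. Y \<omega> \<le> x} \<omega>"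

definition covariance :: "'a measure \<Rightarrow> ('a \<Rightarrow> real) \<Rightarrow> ('a \<Rightarrow> real) \<Rightarrow> real" where
  "covariance M Y Z =
     prob_space.expectation M
       (\<lambda>\<omega>. (Y \<omega> - prob_space.expectation M Y) * (Z \<omega> - prob_space.expectation M Z))"

text \<open>Strict stationarity: all finite-dimensional joint laws are invariant under shifts.\<close>

definition stationary_seq :: "'a measure \<Rightarrow> (nat \<Rightarrow> 'a \<Rightarrow> real) \<Rightarrow> bool" where
  "stationary_seq M Xs \<longleftrightarrow>
     (\<forall>i\<ge>1. Xs i \<in> borel_measurable M) \<and>
     (\<forall>J k. finite J \<and> J \<subseteq> {1..} \<longrightarrow>
        distr M (PiM J (\<lambda>_. borel)) (\<lambda>\<omega>. \<lambda>i\<in>J. Xs (i + k) \<omega>) =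
        distr M (PiM J (\<lambda>_. borel)) (\<lambda>\<omega>. \<lambda>i\<in>J. Xs i \<omega>))"

definition empirical_cdf :: "(nat \<Rightarrow> 'a \<Rightarrow> real) \<Rightarrow> nat \<Rightarrow> 'a \<Rightarrow> real \<Rightarrow> real" where
  "empirical_cdf Xs n \<omega> x = (1 / real n) * (\<Sum>i=1..n. indic_le (Xs i) x \<omega>)"

definition var_cov_sum :: "'a measure \<Rightarrow> (nat \<Rightarrow> 'a \<Rightarrow> real) \<Rightarrow> real \<Rightarrow> nat set \<Rightarrow> real" where
  "var_cov_sum M Xs x I =
     (\<Sum>i\<in>I. prob_space.variance M (indic_le (Xs i) x)) +
     (\<Sum>(i, j)\<in>{(i, j). i \<in> I \<and> j \<in> I \<and> i \<noteq> j}.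
        covariance M (indic_le (Xs i) x) (indic_le (Xs j) x))"

end

theory Submission
  imports Defs "HOL-Library.Discrete_Functions"
begin

text \<open>Write \<open>F(x-)\<close> for the probability of \<open>X < x\<close>. The distribution function and its left limits
can be sandwiched, up to any error \<open>e\<close>, between their values at finitely many points
(\<open>cdf_finite_bracketing\<close>), so uniform convergence follows once the frequency of \<open>{..x}\<close> tends to
\<open>F(x)\<close> and the frequency of \<open>{..<x}\<close> tends to \<open>F(x-)\<close>, almost surely for each fixed \<open>x\<close>
(\<open>glivenko_cantelli_of_pointwise\<close>).

For \<open>{..x}\<close> this is a variance argument. The bracket in the first covariance condition is the
second moment of the centred sum of the first \<open>q\<close> indicators, so along the squares \<open>n = q\<^sup>2\<close> the mean square of
\<open>F\<^sub>n(x) - F(x)\<close> is at most a constant times \<open>q\<close> to the power \<open>-1 - \<delta>\<close>, which is summable. Between \<open>q\<^sup>2\<close> and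
\<open>(q + 1)\<^sup>2\<close> there are only \<open>2q\<close> further indicators, each of size at most \<open>1\<close>, and their contribution
vanishes after division by \<open>n\<close> (\<open>slln_of_second_moment\<close>).

For \<open>{..<x}\<close> the covariance conditions give nothing directly, because their constants at the
points \<open>y < x\<close> may grow without control as \<open>y\<close> increases to \<open>x\<close>; this matters when \<open>x\<close> is an atom of the law. The
needed uniformity comes from stationarity. The frequency of \<open>{..<x}\<close> exceeds that of \<open>{..y}\<close> by
the frequency of the open interval from \<open>y\<close> to \<open>x\<close>, and the maximal ergodic inequality bounds the
probability that this last frequency ever exceeds \<open>l\<close> by \<open>1/l\<close> times the mass of the interval
(\<open>stationary_freq_weak_type\<close>). That mass tends to \<open>0\<close> as \<open>y\<close> increases to \<open>x\<close>
(\<open>freq_lessThan_AE_tendsto\<close>).\<close>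

section \<open>A strong law from second moments along squares\<close>

text \<open>The partial sums move by at most \<open>2 * q\<close> between \<open>q\<^sup>2\<close> and the next square, which is negligible
against \<open>q\<^sup>2\<close>.\<close>
lemma averages_tendsto_0_from_squares:
  fixes s :: "nat \<Rightarrow> real"
  assumes incr: "\<And>n. \<bar>s (Suc n) - s n\<bar> \<le> 1"
    and sq: "(\<lambda>q. s (q\<^sup>2) / real (q\<^sup>2)) \<longlonglongrightarrow> 0"
  shows "(\<lambda>n. s n / real n) \<longlonglongrightarrow> 0"
proof -
  have gap: "\<bar>s (m + k) - s m\<bar> \<le> real k" for m k
  proof (induction k)
    case (Suc k)
    then show ?case using incr[of "m + k"] by simp
  qed simp
  define b where "b q = \<bar>s (q\<^sup>2) / real (q\<^sup>2)\<bar> + 2 / real q" for q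
  have "b \<longlonglongrightarrow> \<bar>0\<bar> + 0"
    unfolding b_def by (intro tendsto_add tendsto_rabs sq lim_const_over_n)
  moreover have "filterlim floor_sqrt at_top sequentially"
    unfolding filterlim_at_top eventually_sequentially
    by (metis floor_sqrt_inverse_power2 mono_floor_sqrt monoD)
  ultimately have lim: "(\<lambda>n. b (floor_sqrt n)) \<longlonglongrightarrow> 0"
    using filterlim_compose by fastforce
  have "\<bar>s n / real n\<bar> \<le> b (floor_sqrt n)" if n: "n > 0" for n
  proof -
    define q where "q = floor_sqrt n"
    have q: "q\<^sup>2 \<le> n" "n < (Suc q)\<^sup>2" "0 < q"
      using n unfolding q_def by (auto simp: Suc_floor_sqrt_power2_gt)
    have "n \<le> q\<^sup>2 + 2 * q" using q(2) by (simp add: power2_eq_square)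
    then have "\<bar>s n - s (q\<^sup>2)\<bar> \<le> 2 * real q"
      using gap[of "q\<^sup>2" "n - q\<^sup>2"] q(1)
        of_nat_mono[of "n - q\<^sup>2" "2 * q", where ?'a = real]
      by (simp del: of_nat_diff)
    then have "\<bar>s n\<bar> \<le> \<bar>s (q\<^sup>2)\<bar> + 2 * real q" by simp
    then have "\<bar>s n\<bar> / real n \<le> (\<bar>s (q\<^sup>2)\<bar> + 2 * real q) / real (q\<^sup>2)"
      using q by (intro frac_le) (simp_all del: of_nat_power)
    also have "\<dots> = b q"
      using q by (simp add: b_def add_divide_distrib power2_eq_square abs_divide)
    finally show ?thesis by (simp add: q_def)
  qed
  then show ?thesis
    by (intro Lim_null_comparison[OF _ lim] eventually_sequentiallyI[of 1]) auto
qed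

text \<open>By monotone convergence the sum of the \<open>Y q\<close> has finite integral, hence is finite almost
everywhere.\<close>
lemma AE_tendsto_0_of_summable_integrals:
  fixes Y :: "nat \<Rightarrow> 'a \<Rightarrow> real"
  assumes int: "\<And>q. integrable M (Y q)" and nonneg: "\<And>q \<omega>. 0 \<le> Y q \<omega>"
    and sum: "summable (\<lambda>q. \<integral>\<omega>. Y q \<omega> \<partial>M)"
  shows "AE \<omega> in M. (\<lambda>q. Y q \<omega>) \<longlonglongrightarrow> 0"
proof -
  have [measurable]: "Y q \<in> borel_measurable M" for q using int by auto
  have "(\<integral>\<^sup>+\<omega>. (\<Sum>q. ennreal (Y q \<omega>)) \<partial>M) = (\<Sum>q. \<integral>\<^sup>+\<omega>. ennreal (Y q \<omega>) \<partial>M)"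
    by (rule nn_integral_suminf) simp
  also have "\<dots> = (\<Sum>q. ennreal (\<integral>\<omega>. Y q \<omega> \<partial>M))"
    using int nonneg by (simp add: nn_integral_eq_integral)
  also have "\<dots> \<noteq> \<infinity>"
    unfolding infinity_ennreal_def
    by (rule ennreal_suminf_neq_top[OF sum]) (simp add: nonneg)
  finally have "AE \<omega> in M. (\<Sum>q. ennreal (Y q \<omega>)) \<noteq> \<infinity>"
    by (intro nn_integral_noteq_infinite) auto
  then show ?thesis
    by eventually_elim
       (use nonneg in \<open>auto intro: summable_LIMSEQ_zero summable_suminf_not_top\<close>)
qed

text \<open>The threshold \<open>3 / 2\<close> is what the sparse sequence of squares gives: the normalised second moment at
\<open>n = q\<^sup>2\<close> has order \<open>q powr (2 * a - 4)\<close>, summable exactly for \<open>a < 3 / 2\<close>.\<close>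
lemma slln_of_second_moment:
  fixes Z :: "nat \<Rightarrow> 'a \<Rightarrow> real"
  assumes "prob_space M" and meas: "\<And>i. 1 \<le> i \<Longrightarrow> Z i \<in> borel_measurable M"
    and bd: "\<And>i \<omega>. \<bar>Z i \<omega>\<bar> \<le> 1"
    and a: "a < 3 / 2"
    and moment: "\<And>n. 1 \<le> n \<Longrightarrow> (\<integral>\<omega>. (\<Sum>i=1..n. Z i \<omega>)\<^sup>2 \<partial>M) \<le> C * real n powr a"
  shows "AE \<omega> in M. (\<lambda>n. (\<Sum>i=1..n. Z i \<omega>) / real n) \<longlonglongrightarrow> 0"
proof -
  interpret prob_space M by fact
  define Y where "Y q \<omega> = ((\<Sum>i=1..q\<^sup>2. Z i \<omega>) / real (q\<^sup>2))\<^sup>2" for q \<omega>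
  have sum_bd: "\<bar>\<Sum>i=1..n. Z i \<omega>\<bar> \<le> real n" for n \<omega>
  proof -
    have "\<bar>\<Sum>i=1..n. Z i \<omega>\<bar> \<le> (\<Sum>i=1..n. \<bar>Z i \<omega>\<bar>)" by (rule sum_abs)
    also have "\<dots> \<le> (\<Sum>i=1..n. 1)" using bd by (intro sum_mono) auto
    finally show ?thesis by simp
  qed
  have int: "integrable M (Y q)" for q
  proof (rule integrable_const_bound[of _ 1])
    show "Y q \<in> borel_measurable M"
      unfolding Y_def using meas
      by (intro borel_measurable_power borel_measurable_divide borel_measurable_sum) auto
    show "AE \<omega> in M. norm (Y q \<omega>) \<le> 1"
      using sum_bd[of _ "q\<^sup>2"] unfolding Y_def
      by (auto simp: abs_square_le_1 divide_le_eq_1 simp del: of_nat_power)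
  qed
  have bound: "(\<integral>\<omega>. Y q \<omega> \<partial>M) \<le> C * real q powr (2 * a - 4)" if "1 \<le> q" for q
  proof -
    have "(\<integral>\<omega>. Y q \<omega> \<partial>M) = (\<integral>\<omega>. (\<Sum>i=1..q\<^sup>2. Z i \<omega>)\<^sup>2 \<partial>M) / real q ^ 4"
      unfolding Y_def by (simp add: power_divide flip: power_mult)
    also have "\<dots> \<le> C * real (q\<^sup>2) powr a / real q ^ 4"
      using moment[of "q\<^sup>2"] that by (intro divide_right_mono) auto
    also have "\<dots> = C * real q powr (2 * a - 4)"
      using that by (simp add: powr_diff powr_realpow powr_powr flip: powr_numeral)
    finally show ?thesis .
  qed
  have "summable (\<lambda>q. C * real q powr (2 * a - 4))"
    using a by (intro summable_mult) (simp add: summable_real_powr_iff)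
  then have "summable (\<lambda>q. \<integral>\<omega>. Y q \<omega> \<partial>M)"
    by (rule summable_comparison_test')
       (use bound in \<open>auto simp: Y_def integral_nonneg_AE\<close>)
  then have "AE \<omega> in M. (\<lambda>q. Y q \<omega>) \<longlonglongrightarrow> 0"
    by (intro AE_tendsto_0_of_summable_integrals int) (auto simp: Y_def)
  then show ?thesis
  proof eventually_elim
    case (elim \<omega>)
    then have "(\<lambda>q. (\<Sum>i=1..q\<^sup>2. Z i \<omega>) / real (q\<^sup>2)) \<longlonglongrightarrow> 0"
      unfolding Y_def by (subst (asm) power_tendsto_0_iff) auto
    then show ?case
      by (intro averages_tendsto_0_from_squares) (use bd in auto)
  qed
qed

text \<open>Expanding the square of the centred sum, the diagonal gives the variances and the other pairs the
covariances.\<close>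
lemma var_cov_sum_eq:
  assumes "prob_space M" and "finite I"
    and meas: "\<And>i. i \<in> I \<Longrightarrow> Xs i \<in> borel_measurable M"
    and mean: "\<And>i. i \<in> I \<Longrightarrow> (\<integral>\<omega>. indic_le (Xs i) x \<omega> \<partial>M) = p"
  shows "var_cov_sum M Xs x I = (\<integral>\<omega>. (\<Sum>i\<in>I. indic_le (Xs i) x \<omega> - p)\<^sup>2 \<partial>M)"
proof -
  interpret prob_space M by fact
  define D where "D i \<omega> = indic_le (Xs i) x \<omega> - p" for i \<omega>
  have D [measurable]: "D i \<in> borel_measurable M" if "i \<in> I" for i
    using meas[OF that] unfolding D_def indic_le_def indicator_def by measurable
  have bd: "\<bar>D i \<omega>\<bar> \<le> 1 + \<bar>p\<bar>" for i \<omega>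
    unfolding D_def indic_le_def by (auto simp: indicator_def)
  have int: "integrable M (\<lambda>\<omega>. D i \<omega> * D j \<omega>)" if "i \<in> I" "j \<in> I" for i j
    by (rule integrable_const_bound[of _ "(1 + \<bar>p\<bar>) * (1 + \<bar>p\<bar>)"])
       (use that bd in \<open>auto simp: abs_mult intro!: mult_mono\<close>)
  have diag: "variance (indic_le (Xs i) x) = (\<integral>\<omega>. D i \<omega> * D i \<omega> \<partial>M)" if "i \<in> I" for i
    using mean[OF that] by (simp add: D_def power2_eq_square)
  have off: "covariance M (indic_le (Xs i) x) (indic_le (Xs j) x) = (\<integral>\<omega>. D i \<omega> * D j \<omega> \<partial>M)"
    if "i \<in> I" "j \<in> I" for i j
    using mean that by (simp add: covariance_def D_def)
  let ?N = "{(i, j). i \<in> I \<and> j \<in> I \<and> i \<noteq> j}" and ?E = "(\<lambda>i. (i, i)) ` I"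
  have "(\<integral>\<omega>. (\<Sum>i\<in>I. D i \<omega>)\<^sup>2 \<partial>M) = (\<integral>\<omega>. (\<Sum>(i, j)\<in>I \<times> I. D i \<omega> * D j \<omega>) \<partial>M)"
    by (simp add: power2_eq_square sum_product sum.cartesian_product)
  also have "\<dots> = (\<Sum>(i, j)\<in>I \<times> I. \<integral>\<omega>. D i \<omega> * D j \<omega> \<partial>M)"
    using int by (auto simp: case_prod_beta intro!: Bochner_Integration.integral_sum)
  also have "I \<times> I = ?E \<union> ?N" by auto
  also have "(\<Sum>(i, j)\<in>?E \<union> ?N. \<integral>\<omega>. D i \<omega> * D j \<omega> \<partial>M) =
      (\<Sum>(i, j)\<in>?E. \<integral>\<omega>. D i \<omega> * D j \<omega> \<partial>M) + (\<Sum>(i, j)\<in>?N. \<integral>\<omega>. D i \<omega> * D j \<omega> \<partial>M)"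
    by (rule sum.union_disjoint)
       (use \<open>finite I\<close> in \<open>auto intro: finite_subset[of _ "I \<times> I"]\<close>)
  also have "(\<Sum>(i, j)\<in>?E. \<integral>\<omega>. D i \<omega> * D j \<omega> \<partial>M) = (\<Sum>i\<in>I. \<integral>\<omega>. D i \<omega> * D i \<omega> \<partial>M)"
    by (subst sum.reindex) (auto simp: inj_on_def)
  finally have "(\<integral>\<omega>. (\<Sum>i\<in>I. D i \<omega>)\<^sup>2 \<partial>M) = var_cov_sum M Xs x I"
    unfolding var_cov_sum_def using diag off
    by (auto intro!: arg_cong2[where f="(+)"] sum.cong)
  then show ?thesis by (simp add: D_def)
qed

section \<open>The maximal ergodic inequality\<close>

text \<open>The value \<open>k = 0\<close> is included, so the maximum is never negative; it is positive exactly when some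
nonempty partial sum is.\<close>
definition max_partial_sum :: "nat \<Rightarrow> (nat \<Rightarrow> real) \<Rightarrow> real" where
  "max_partial_sum K y = (MAX k\<in>{..K}. \<Sum>i=1..k. y i)"

lemma partial_sum_le_max: "k \<le> K \<Longrightarrow> (\<Sum>i=1..k. y i) \<le> max_partial_sum K y"
  unfolding max_partial_sum_def by (rule Max_ge) auto

lemma max_partial_sum_nonneg: "0 \<le> max_partial_sum K y"
  using partial_sum_le_max[of 0 K y] by simp

text \<open>A positive maximum is attained by a nonempty sum; removing its first term leaves a partial sum of the
shifted sequence. This is the pointwise step of Garsia's proof of the maximal ergodic theorem.\<close>
lemma max_partial_sum_shift:
  assumes "0 < max_partial_sum K y"
  shows "max_partial_sum K y \<le> y 1 + max_partial_sum K (\<lambda>i. y (Suc i))"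
proof -
  have "max_partial_sum K y \<in> (\<lambda>k. \<Sum>i=1..k. y i) ` {..K}"
    unfolding max_partial_sum_def by (rule Max_in) auto
  then obtain k where k: "k \<le> K" "max_partial_sum K y = (\<Sum>i=1..k. y i)" by auto
  with assms obtain l where l: "k = Suc l" by (cases k) auto
  have "(\<Sum>i=1..k. y i) = y 1 + (\<Sum>i=1..l. y (Suc i))"
    unfolding l One_nat_def
    by (subst sum.atLeast_Suc_atMost)
       (simp_all add: sum.shift_bounds_cl_Suc_ivl del: sum.cl_ivl_Suc)
  also have "\<dots> \<le> y 1 + max_partial_sum K (\<lambda>i. y (Suc i))"
    using partial_sum_le_max[of l K "\<lambda>i. y (Suc i)"] k l by simp
  finally show ?thesis using k by simp
qed

lemma max_partial_sum_cong:
  "(\<And>i. 1 \<le> i \<Longrightarrow> i \<le> K \<Longrightarrow> y i = z i) \<Longrightarrow> max_partial_sum K y = max_partial_sum K z"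
  unfolding max_partial_sum_def by (intro arg_cong[where f=Max] image_cong refl sum.cong) auto

lemma measurable_max_partial_sum:
  assumes "\<And>i. 1 \<le> i \<Longrightarrow> i \<le> K \<Longrightarrow> (\<lambda>\<omega>. Y i \<omega>) \<in> borel_measurable M"
  shows "(\<lambda>\<omega>. max_partial_sum K (\<lambda>i. Y i \<omega>)) \<in> borel_measurable M"
  unfolding max_partial_sum_def
  by (rule borel_measurable_Max) (use assms in \<open>auto intro!: borel_measurable_sum\<close>)

lemma integrable_max_partial_sum:
  assumes "\<And>i. 1 \<le> i \<Longrightarrow> i \<le> K \<Longrightarrow> integrable M (\<lambda>\<omega>. Y i \<omega> :: real)"
  shows "integrable M (\<lambda>\<omega>. max_partial_sum K (\<lambda>i. Y i \<omega>))"
  unfolding max_partial_sum_def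
  by (rule integrable_MAX) (use assms in auto)

text \<open>The maximal ergodic theorem in Garsia's form. Where the maximum \<open>A\<close> is positive,
\<open>max_partial_sum_shift\<close> bounds \<open>A - B\<close> by the first term, \<open>B\<close> being the maximum for the shifted
sequence; elsewhere \<open>A - B \<le> 0\<close>. Stationarity makes \<open>A\<close> and \<open>B\<close> equal in law, so \<open>A - B\<close> has mean
zero.\<close>
lemma stationary_maximal_ergodic:
  fixes g :: "real \<Rightarrow> real"
  assumes "prob_space M" and stat: "stationary_seq M Xs"
    and g [measurable]: "g \<in> borel_measurable borel"
    and int: "\<And>i. 1 \<le> i \<Longrightarrow> integrable M (\<lambda>\<omega>. g (Xs i \<omega>))"
  shows "0 \<le> (\<integral>\<omega>. g (Xs 1 \<omega>) *
      indicator {\<omega>. 0 < max_partial_sum K (\<lambda>i. g (Xs i \<omega>))} \<omega> \<partial>M)"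
proof -
  have meas: "Xs i \<in> borel_measurable M" if "1 \<le> i" for i
    using stat that by (auto simp: stationary_seq_def)
  define A where "A \<omega> = max_partial_sum K (\<lambda>i. g (Xs i \<omega>))" for \<omega>
  define B where "B \<omega> = max_partial_sum K (\<lambda>i. g (Xs (Suc i) \<omega>))" for \<omega>
  have intA: "integrable M A" and intB: "integrable M B"
    unfolding A_def B_def using int by (auto intro!: integrable_max_partial_sum)
  \<comment> \<open>Both maxima are the same functional \<open>h\<close> of \<open>K\<close> consecutive values, so their laws agree.\<close>
  define h where "h y = max_partial_sum K (\<lambda>i. g (y i))" for y :: "nat \<Rightarrow> real"
  let ?P = "PiM {1..K} (\<lambda>_. borel) :: (nat \<Rightarrow> real) measure"
  have h: "h \<in> borel_measurable ?P"
    unfolding h_def by (rule measurable_max_partial_sum) auto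
  have law: "distr M ?P (\<lambda>\<omega>. \<lambda>i\<in>{1..K}. Xs (i + 1) \<omega>) = distr M ?P (\<lambda>\<omega>. \<lambda>i\<in>{1..K}. Xs i \<omega>)"
    using stat unfolding stationary_seq_def
    by (metis atLeastAtMost_iff atLeast_iff finite_atLeastAtMost subsetI)
  have eqA: "A \<omega> = h (\<lambda>i\<in>{1..K}. Xs i \<omega>)" and eqB: "B \<omega> = h (\<lambda>i\<in>{1..K}. Xs (i + 1) \<omega>)" for \<omega>
    unfolding A_def B_def h_def by (rule max_partial_sum_cong; simp)+
  have "integral\<^sup>L M A = integral\<^sup>L (distr M ?P (\<lambda>\<omega>. \<lambda>i\<in>{1..K}. Xs i \<omega>)) h"
    unfolding eqA using h meas by (intro integral_distr[symmetric] measurable_restrict) auto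
  also have "\<dots> = integral\<^sup>L M B"
    unfolding eqB law[symmetric] using h meas by (intro integral_distr measurable_restrict) auto
  finally have AB: "integral\<^sup>L M A = integral\<^sup>L M B" .
  have [measurable]: "A \<in> borel_measurable M" "Xs 1 \<in> borel_measurable M"
    using intA meas by auto
  have "0 = (\<integral>\<omega>. A \<omega> - B \<omega> \<partial>M)"
    using AB intA intB by simp
  also have "\<dots> \<le> (\<integral>\<omega>. g (Xs 1 \<omega>) * indicator {\<omega>. 0 < A \<omega>} \<omega> \<partial>M)"
  proof (rule integral_mono)
    show "integrable M (\<lambda>\<omega>. A \<omega> - B \<omega>)" using intA intB by simp
    show "integrable M (\<lambda>\<omega>. g (Xs 1 \<omega>) * indicator {\<omega>. 0 < A \<omega>} \<omega>)"
    proof (rule Bochner_Integration.integrable_bound[OF int[of 1]])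
      show "(\<lambda>\<omega>. g (Xs 1 \<omega>) * indicator {\<omega>. 0 < A \<omega>} \<omega>) \<in> borel_measurable M"
        unfolding indicator_def by measurable
    qed (auto simp: indicator_def)
    show "A \<omega> - B \<omega> \<le> g (Xs 1 \<omega>) * indicator {\<omega>. 0 < A \<omega>} \<omega>" for \<omega>
    proof (cases "0 < A \<omega>")
      case True
      then show ?thesis
        using max_partial_sum_shift[of K "\<lambda>i. g (Xs i \<omega>)"] by (simp add: A_def B_def)
    next
      case False
      then show ?thesis
        using max_partial_sum_nonneg[of K "\<lambda>i. g (Xs (Suc i) \<omega>)"] by (simp add: B_def)
    qed
  qed
  finally show ?thesis by (simp add: A_def)
qed

section \<open>Frequencies of sets\<close>

definition freq :: "(nat \<Rightarrow> 'a \<Rightarrow> real) \<Rightarrow> real set \<Rightarrow> nat \<Rightarrow> 'a \<Rightarrow> real" where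
  "freq Xs S n \<omega> = (\<Sum>i=1..n. indicator S (Xs i \<omega>)) / real n"

lemma freq_nonneg: "0 \<le> freq Xs S n \<omega>"
  unfolding freq_def by (intro divide_nonneg_nonneg sum_nonneg) auto

lemma freq_mono: "S \<subseteq> T \<Longrightarrow> freq Xs S n \<omega> \<le> freq Xs T n \<omega>"
  unfolding freq_def by (intro divide_right_mono sum_mono) (auto simp: indicator_def)

lemma freq_le_1: "freq Xs S n \<omega> \<le> 1"
proof -
  have "(\<Sum>i=1..n. indicator S (Xs i \<omega>) :: real) \<le> (\<Sum>i=1..n. 1)"
    by (intro sum_mono) (auto simp: indicator_def)
  then show ?thesis unfolding freq_def by (cases "n = 0") (simp_all add: divide_le_eq_1)
qed

lemma freq_Un: "S \<inter> T = {} \<Longrightarrow> freq Xs (S \<union> T) n \<omega> = freq Xs S n \<omega> + freq Xs T n \<omega>"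
  unfolding freq_def
  by (simp add: add_divide_distrib[symmetric] sum.distrib[symmetric] indicator_add)

lemma empirical_cdf_eq_freq: "empirical_cdf Xs n \<omega> x = freq Xs {..x} n \<omega>"
  unfolding empirical_cdf_def freq_def indic_le_def by (simp add: indicator_def)

text \<open>A weak type bound, uniform in the number of observations. The frequency of \<open>S\<close> exceeds \<open>l\<close> at time
\<open>n\<close> exactly when the \<open>n\<close>-th partial sum of the indicators of \<open>S\<close> minus \<open>l\<close> is positive, so the maximal
ergodic theorem applies to that difference, first for times up to \<open>K\<close>.\<close>
lemma stationary_freq_weak_type:
  assumes "prob_space M" and stat: "stationary_seq M Xs"
    and S [measurable]: "S \<in> sets borel" and l: "0 < l"
  shows "measure M {\<omega>\<in>space M. \<exists>n. l < freq Xs S n \<omega>}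
    \<le> measure M {\<omega>\<in>space M. Xs 1 \<omega> \<in> S} / l"
proof -
  interpret prob_space M by fact
  have meas: "Xs i \<in> borel_measurable M" if "1 \<le> i" for i
    using stat that by (auto simp: stationary_seq_def)
  have [measurable]: "(\<lambda>\<omega>. freq Xs S n \<omega>) \<in> borel_measurable M" for n
    unfolding freq_def using meas by (intro borel_measurable_divide borel_measurable_sum) auto
  have X1 [measurable]: "Xs 1 \<in> borel_measurable M" using meas by simp
  define V where "V = {\<omega>\<in>space M. Xs 1 \<omega> \<in> S}"
  have [measurable]: "V \<in> sets M" unfolding V_def by measurable
  define E where "E K = {\<omega>\<in>space M. \<exists>n\<le>K. l < freq Xs S n \<omega>}" for K
  define g where "g y = indicator S y - l" for y :: real
  have [measurable]: "g \<in> borel_measurable borel" unfolding g_def by measurable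
  have "measure M (E K) \<le> measure M V / l" for K
  proof -
    define A where "A = {\<omega>\<in>space M. 0 < max_partial_sum K (\<lambda>i. g (Xs i \<omega>))}"
    have mA [measurable]: "(\<lambda>\<omega>. max_partial_sum K (\<lambda>i. g (Xs i \<omega>))) \<in> borel_measurable M"
      using meas by (intro measurable_max_partial_sum) auto
    have [measurable]: "A \<in> sets M" unfolding A_def by measurable
    have int: "integrable M (\<lambda>\<omega>. g (Xs i \<omega>))" if "1 \<le> i" for i
    proof -
      have [measurable]: "Xs i \<in> borel_measurable M" using meas that by simp
      show ?thesis
        by (rule integrable_const_bound[of _ "1 + l"])
           (use l in \<open>auto simp: g_def indicator_def\<close>)
    qed
    have "E K \<subseteq> A"
    proof
      fix \<omega> assume "\<omega> \<in> E K"
      then obtain n where n: "n \<le> K" "l < freq Xs S n \<omega>" "\<omega> \<in> space M" by (auto simp: E_def)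
      have "n \<noteq> 0" using n l by (auto simp: freq_def intro!: Nat.gr0I)
      with n have "0 < (\<Sum>i=1..n. g (Xs i \<omega>))"
        by (simp add: g_def freq_def sum_subtractf pos_less_divide_eq mult.commute)
      also have "\<dots> \<le> max_partial_sum K (\<lambda>i. g (Xs i \<omega>))"
        using n by (intro partial_sum_le_max)
      finally show "\<omega> \<in> A" using n by (simp add: A_def)
    qed
    then have "measure M (E K) \<le> measure M A" by (rule finite_measure_mono) simp
    have "0 \<le> (\<integral>\<omega>. g (Xs 1 \<omega>) *
        indicator {\<omega>. 0 < max_partial_sum K (\<lambda>i. g (Xs i \<omega>))} \<omega> \<partial>M)"
      by (rule stationary_maximal_ergodic) (use assms int in auto)
    also have "\<dots> \<le> (\<integral>\<omega>. indicator V \<omega> - l * indicator A \<omega> \<partial>M)"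
    proof (rule integral_mono)
      show "integrable M (\<lambda>\<omega>. g (Xs 1 \<omega>) *
          indicator {\<omega>. 0 < max_partial_sum K (\<lambda>i. g (Xs i \<omega>))} \<omega>)"
      proof (rule Bochner_Integration.integrable_bound[OF int[of 1]])
        show "(\<lambda>\<omega>. g (Xs 1 \<omega>) * indicator {\<omega>. 0 < max_partial_sum K (\<lambda>i. g (Xs i \<omega>))} \<omega>)
            \<in> borel_measurable M"
          unfolding indicator_def by measurable
      qed (auto simp: indicator_def)
      show "integrable M (\<lambda>\<omega>. indicator V \<omega> - l * indicator A \<omega> :: real)"
        by (intro Bochner_Integration.integrable_diff integrable_mult_right integrable_real_indicator)
           (measurable, simp_all add: emeasure_eq_measure)
    qed (auto simp: A_def V_def g_def indicator_def)
    also have "\<dots> = measure M V - l * measure M A"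
      by (subst Bochner_Integration.integral_diff) (simp_all add: emeasure_eq_measure)
    finally have "measure M A \<le> measure M V / l"
      using l by (simp add: field_simps)
    with \<open>measure M (E K) \<le> measure M A\<close> show ?thesis by simp
  qed
  moreover have "(\<lambda>K. measure M (E K)) \<longlonglongrightarrow> measure M (\<Union>K. E K)"
  proof (rule finite_Lim_measure_incseq)
    show "range E \<subseteq> sets M" unfolding E_def by auto
    show "incseq E" by (rule incseq_SucI) (use le_SucI in \<open>unfold E_def, blast\<close>)
  qed
  moreover have "(\<Union>K. E K) = {\<omega>\<in>space M. \<exists>n. l < freq Xs S n \<omega>}"
    by (auto simp: E_def)
  ultimately show ?thesis unfolding V_def by (auto intro: LIMSEQ_le_const2)
qed

section \<open>Almost sure convergence at a fixed point\<close>

text \<open>The indicators centred at \<open>p\<close> lie between \<open>-1\<close> and \<open>1\<close>, so the second moment law applies to them.\<close>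
lemma freq_atMost_AE_tendsto:
  assumes "prob_space M" and meas: "\<And>i. 1 \<le> i \<Longrightarrow> Xs i \<in> borel_measurable M"
    and mean: "\<And>i. 1 \<le> i \<Longrightarrow> (\<integral>\<omega>. indic_le (Xs i) x \<omega> \<partial>M) = p"
    and p: "0 \<le> p" "p \<le> 1" and a: "a < 3 / 2"
    and bound: "\<And>q. 1 \<le> q \<Longrightarrow> var_cov_sum M Xs x {1..q} \<le> C * real q powr a"
  shows "AE \<omega> in M. (\<lambda>n. freq Xs {..x} n \<omega>) \<longlonglongrightarrow> p"
proof -
  define Z where "Z i \<omega> = indic_le (Xs i) x \<omega> - p" for i \<omega>
  have "AE \<omega> in M. (\<lambda>n. (\<Sum>i=1..n. Z i \<omega>) / real n) \<longlonglongrightarrow> 0"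
  proof (rule slln_of_second_moment[OF \<open>prob_space M\<close> _ _ a])
    show "Z i \<in> borel_measurable M" if "1 \<le> i" for i
      using meas[OF that] unfolding Z_def indic_le_def indicator_def by measurable
    show "\<bar>Z i \<omega>\<bar> \<le> 1" for i \<omega>
      using p by (auto simp: Z_def indic_le_def indicator_def)
    show "(\<integral>\<omega>. (\<Sum>i=1..n. Z i \<omega>)\<^sup>2 \<partial>M) \<le> C * real n powr a" if "1 \<le> n" for n
      using var_cov_sum_eq[OF \<open>prob_space M\<close>, of "{1..n}" Xs x p] meas mean bound[OF that]
      by (simp add: Z_def)
  qed
  then show ?thesis
  proof eventually_elim
    case (elim \<omega>)
    have "(\<Sum>i=1..n. Z i \<omega>) / real n = freq Xs {..x} n \<omega> - p" if "n \<ge> 1" for n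
      using that by (simp add: Z_def freq_def indic_le_def sum_subtractf diff_divide_distrib indicator_def)
    with elim have "(\<lambda>n. freq Xs {..x} n \<omega> - p) \<longlonglongrightarrow> 0"
      by (auto elim!: Lim_transform_eventually intro!: eventually_sequentiallyI[of 1])
    then show ?case by (simp add: LIM_zero_iff)
  qed
qed

text \<open>With \<open>y\<close> increasing to \<open>x\<close>, the frequency of \<open>{..y}\<close> bounds that of \<open>{..<x}\<close> from below and leaves a
frequency of a short interval \<open>W\<close> as the error. The weak type bound makes this error at most \<open>l\<close> for
all \<open>n\<close> at once, for almost every \<open>\<omega>\<close> and a suitable \<open>y\<close> depending on \<open>\<omega>\<close>.\<close>
lemma freq_lessThan_AE_tendsto:
  assumes "prob_space M" and stat: "stationary_seq M Xs"
    and law: "distr M borel (Xs 1) = \<nu>"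
    and atMost: "\<And>y. AE \<omega> in M. (\<lambda>n. freq Xs {..y} n \<omega>) \<longlonglongrightarrow> cdf \<nu> y"
  shows "AE \<omega> in M. (\<lambda>n. freq Xs {..<x} n \<omega>) \<longlonglongrightarrow> measure \<nu> {..<x}"
proof -
  interpret prob_space M by fact
  have meas: "Xs i \<in> borel_measurable M" if "1 \<le> i" for i
    using stat that by (auto simp: stationary_seq_def)
  have [measurable]: "(\<lambda>\<omega>. freq Xs S n \<omega>) \<in> borel_measurable M" if "S \<in> sets borel" for S n
    unfolding freq_def using meas that by (intro borel_measurable_divide borel_measurable_sum) auto
  have X1 [measurable]: "Xs 1 \<in> borel_measurable M" using meas by simp
  interpret \<nu>: real_distribution \<nu>
    unfolding law[symmetric] by (rule real_distribution_distr[OF X1])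
  define y where "y k = x - 1 / real (Suc k)" for k
  define W where "W k = {y k<..<x}" for k
  have [measurable]: "W k \<in> sets borel" for k by (simp add: W_def)
  have y: "y k < x" for k by (simp add: y_def)
  have un: "{..<x} = {..y k} \<union> W k" and disj: "{..y k} \<inter> W k = {}" for k
    using y[of k] by (auto simp: W_def)
  have split: "measure \<nu> {..<x} = cdf \<nu> (y k) + measure \<nu> (W k)" for k
    unfolding un[of k] cdf_def by (rule \<nu>.finite_measure_Union) (use disj in auto)
  have W_lim: "(\<lambda>k. measure \<nu> (W k)) \<longlonglongrightarrow> 0"
  proof -
    have "(\<lambda>k. x - 1 / real (Suc k)) \<longlonglongrightarrow> x - 0"
      by (intro tendsto_diff tendsto_const LIMSEQ_Suc[OF lim_1_over_n])
    then have "filterlim y (at_left x) sequentially"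
      using y by (simp add: filterlim_at y_def[abs_def])
    then have "(\<lambda>k. measure \<nu> {..<x} - cdf \<nu> (y k)) \<longlonglongrightarrow> measure \<nu> {..<x} - measure \<nu> {..<x}"
      by (intro tendsto_diff tendsto_const filterlim_compose[OF \<nu>.cdf_at_left])
    moreover have "measure \<nu> {..<x} - cdf \<nu> (y k) = measure \<nu> (W k)" for k
      using split[of k] by simp
    ultimately show ?thesis by simp
  qed
  have small: "AE \<omega> in M. \<exists>k. \<forall>n. freq Xs (W k) n \<omega> \<le> l" if l: "0 < l" for l
  proof -
    define B where "B = {\<omega>\<in>space M. \<forall>k. \<exists>n. l < freq Xs (W k) n \<omega>}"
    have [measurable]: "B \<in> sets M" unfolding B_def by measurable
    have "measure M B \<le> measure \<nu> (W k) / l" for k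
    proof -
      have "measure M B \<le> measure M {\<omega>\<in>space M. \<exists>n. l < freq Xs (W k) n \<omega>}"
        by (rule finite_measure_mono) (auto simp: B_def)
      also have "\<dots> \<le> measure M {\<omega>\<in>space M. Xs 1 \<omega> \<in> W k} / l"
        by (rule stationary_freq_weak_type) (use assms l in auto)
      also have "{\<omega>\<in>space M. Xs 1 \<omega> \<in> W k} = Xs 1 -` W k \<inter> space M" by auto
      also have "measure M (Xs 1 -` W k \<inter> space M) = measure \<nu> (W k)"
        unfolding law[symmetric] by (rule measure_distr[OF X1, symmetric]) simp
      finally show ?thesis .
    qed
    moreover have "(\<lambda>k. measure \<nu> (W k) / l) \<longlonglongrightarrow> 0"
      using tendsto_divide_zero[OF W_lim] by simp
    ultimately have "measure M B \<le> 0" by (intro LIMSEQ_le_const) auto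
    then have "B \<in> null_sets M"
      by (auto simp: null_sets_def emeasure_eq_measure measure_nonneg intro: antisym)
    then show ?thesis by (rule AE_I') (auto simp: B_def not_le)
  qed
  have "AE \<omega> in M. \<forall>k. (\<lambda>n. freq Xs {..y k} n \<omega>) \<longlonglongrightarrow> cdf \<nu> (y k)"
    by (simp add: AE_all_countable atMost)
  moreover have "AE \<omega> in M. \<forall>m. \<exists>k. \<forall>n. freq Xs (W k) n \<omega> \<le> 1 / real (Suc m)"
    unfolding AE_all_countable by (intro allI small) simp
  ultimately show ?thesis
  proof eventually_elim
    case (elim \<omega>)
    have freq_split: "freq Xs {..<x} n \<omega> = freq Xs {..y k} n \<omega> + freq Xs (W k) n \<omega>" for n k
      unfolding un[of k] by (rule freq_Un[OF disj])
    show ?case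
    proof (rule order_tendstoI)
      fix c assume "c < measure \<nu> {..<x}"
      then have "\<forall>\<^sub>F k in sequentially. measure \<nu> (W k) < measure \<nu> {..<x} - c"
        by (intro order_tendstoD[OF W_lim]) simp
      then obtain k where "measure \<nu> (W k) < measure \<nu> {..<x} - c"
        by (auto dest!: eventually_happens)
      then have "c < cdf \<nu> (y k)" using split[of k] by simp
      with elim have "\<forall>\<^sub>F n in sequentially. c < freq Xs {..y k} n \<omega>"
        by (auto intro: order_tendstoD)
      then show "\<forall>\<^sub>F n in sequentially. c < freq Xs {..<x} n \<omega>"
      proof eventually_elim
        case (elim n)
        then show ?case using freq_split[of n k] freq_nonneg[of Xs "W k" n \<omega>] by simp
      qed
    next
      \<comment> \<open>The interval must be chosen for this \<open>\<omega>\<close>, so that its frequency is small for every \<open>n\<close>.\<close>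
      fix c assume c: "measure \<nu> {..<x} < c"
      then obtain m where m: "1 / real (Suc m) < c - measure \<nu> {..<x}"
        using nat_approx_posE[of "c - measure \<nu> {..<x}"] by auto
      from elim obtain k where k: "\<And>n. freq Xs (W k) n \<omega> \<le> 1 / real (Suc m)" by blast
      have "cdf \<nu> (y k) < c - 1 / real (Suc m)"
        using m split[of k] measure_nonneg[of \<nu> "W k"] by linarith
      with elim have "\<forall>\<^sub>F n in sequentially. freq Xs {..y k} n \<omega> < c - 1 / real (Suc m)"
        by (auto intro: order_tendstoD)
      then show "\<forall>\<^sub>F n in sequentially. freq Xs {..<x} n \<omega> < c"
      proof eventually_elim
        case (elim n)
        then show ?case using freq_split[of n k] k[of n] by linarith
      qed
    qed
  qed
qed

section \<open>From pointwise to uniform convergence\<close>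

text \<open>The points are the quantiles \<open>Q (k / m)\<close> for \<open>0 < k < m\<close> with \<open>1 / m \<le> e\<close>. The
upper bound for \<open>x < t\<close> uses the left limit at \<open>t\<close> instead of the value, since the distribution
function may jump by more than \<open>e\<close> at \<open>t\<close>. In the two tails no point is needed: there \<open>0\<close> or \<open>1\<close> already approximates the distribution function.\<close>
lemma cdf_finite_bracketing:
  assumes "real_distribution \<nu>" and e: "0 < e"
  shows "\<exists>T. finite T \<and> (\<forall>x.
      (cdf \<nu> x \<le> e \<or> (\<exists>t\<in>T. t \<le> x \<and> cdf \<nu> x \<le> cdf \<nu> t + e)) \<and>
      (1 \<le> cdf \<nu> x + e \<or> (\<exists>t\<in>T. x < t \<and> measure \<nu> {..<t} \<le> cdf \<nu> x + e)))"
proof -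
  interpret real_distribution \<nu> by fact
  define F where "F = cdf \<nu>"
  define Q where "Q p = Inf {x. p \<le> F x}" for p
  \<comment> \<open>Right continuity makes the infimum a minimum, which gives this Galois connection.\<close>
  have Q_le: "Q p \<le> x \<longleftrightarrow> p \<le> F x" if p: "0 < p" "p < 1" for p x
  proof -
    let ?A = "{x. p \<le> F x}"
    have "\<forall>\<^sub>F x in at_top. p < F x"
      using cdf_lim_at_top_prob p unfolding F_def by (intro order_tendstoD)
    then have ne: "?A \<noteq> {}"
      by (metis (mono_tags, lifting) empty_Collect_eq eventually_at_top_linorder less_imp_le order_refl)
    have "\<forall>\<^sub>F x in at_bot. F x < p"
      using cdf_lim_at_bot p unfolding F_def by (intro order_tendstoD)
    then obtain L where "\<And>x. x \<le> L \<Longrightarrow> F x < p" by (auto simp: eventually_at_bot_linorder)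
    then have bdd: "bdd_below ?A" by (intro bdd_belowI[of _ L]) (metis linorder_le_cases mem_Collect_eq not_le)
    have "p \<le> F (Q p)"
    proof (rule ccontr)
      assume "\<not> p \<le> F (Q p)"
      moreover have "(F \<longlongrightarrow> F (Q p)) (at_right (Q p))"
        using cdf_is_right_cont[of "Q p"] by (simp add: F_def continuous_within)
      ultimately have "\<forall>\<^sub>F x in at_right (Q p). F x < p"
        by (intro order_tendstoD) auto
      then obtain b where b: "Q p < b" "\<And>y. Q p < y \<Longrightarrow> y < b \<Longrightarrow> F y < p"
        by (auto simp: eventually_at_right_field)
      have "b \<le> Q p"
        unfolding Q_def
      proof (rule cInf_greatest[OF ne])
        fix y assume "y \<in> ?A"
        moreover have "F y < p" if "y < b"
        proof -
          define z where "z = max y ((Q p + b) / 2)"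
          have "F y \<le> F z" unfolding F_def z_def by (intro cdf_nondecreasing) simp
          also have "F z < p" using b that by (intro b(2)) (auto simp: z_def max_def)
          finally show ?thesis .
        qed
        ultimately show "b \<le> y" by force
      qed
      with b show False by simp
    qed
    then show ?thesis
      using cInf_lower[OF _ bdd, of x] cdf_nondecreasing[of "Q p" x]
      by (auto simp: Q_def F_def)
  qed
  have Q_left: "measure \<nu> {..<Q p} \<le> p" if p: "0 < p" "p < 1" for p
  proof (rule tendsto_upperbound[OF cdf_at_left])
    have "cdf \<nu> x \<le> p" if "x < Q p" for x
      using Q_le[OF p, of x] that by (simp add: F_def)
    then show "\<forall>\<^sub>F x in at_left (Q p). cdf \<nu> x \<le> p"
      unfolding eventually_at_left_field by (intro exI[of _ "Q p - 1"]) simp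
  qed simp
  obtain m :: nat where m: "1 / e < real m" using reals_Archimedean2 by blast
  then have m0: "0 < m"
    using e by (metis less_numeral_extra(3) not_gr_zero of_nat_0 order_less_trans zero_less_divide_1_iff)
  have me: "1 / real m \<le> e" using m m0 e by (simp add: field_simps)
  define T where "T = (\<lambda>k. Q (real k / real m)) ` {1..<m}"
  have in_T: "Q (real k / real m) \<in> T" if "0 < k" "k < m" for k
    using that by (auto simp: T_def)
  have "(F x \<le> e \<or> (\<exists>t\<in>T. t \<le> x \<and> F x \<le> F t + e)) \<and>
      (1 \<le> F x + e \<or> (\<exists>t\<in>T. x < t \<and> measure \<nu> {..<t} \<le> F x + e))" for x
  proof -
    have Fx: "0 \<le> F x" "F x \<le> 1" by (simp_all add: F_def cdf_nonneg cdf_bounded_prob)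
    define j where "j = nat \<lfloor>real m * F x\<rfloor>"
    have j: "real j \<le> real m * F x" "real m * F x < real j + 1"
      using Fx unfolding j_def by (simp_all add: of_nat_nat)
    then have jm: "real j / real m \<le> F x" "F x < real (Suc j) / real m"
      using m0 by (simp_all add: field_simps)
    have "real j \<le> real m" using j(1) Fx m0 mult_left_le[of "F x" "real m"] by linarith
    then have "j \<le> m" by simp
    have split: "real (Suc k) / real m = real k / real m + 1 / real m" for k
      by (simp add: add_divide_distrib)
    show ?thesis
    proof
      show "F x \<le> e \<or> (\<exists>t\<in>T. t \<le> x \<and> F x \<le> F t + e)"
      \<comment> \<open>If \<open>F x = 1\<close> then \<open>j = m\<close>, and the last quantile level \<open>(m - 1) / m\<close> is used instead.\<close>
      proof (cases "min j (m - 1)")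
        case 0
        then have "F x \<le> 1 / real m"
          using jm Fx m0 \<open>j \<le> m\<close> by (cases "m = 1") (auto simp: min_def split: if_splits)
        then show ?thesis using me by simp
      next
        case (Suc k)
        define t where "t = Q (real (Suc k) / real m)"
        have k: "Suc k \<le> j" "Suc k < m" using Suc m0 by auto
        have p: "0 < real (Suc k) / real m" "real (Suc k) / real m < 1" using k by auto
        have "real (Suc k) / real m \<le> F x"
          using k jm(1) m0 by (meson divide_right_mono of_nat_0_le_iff of_nat_mono order_trans)
        then have "t \<le> x" using Q_le[OF p] by (simp add: t_def)
        moreover have "F x \<le> real (Suc k) / real m + 1 / real m"
        proof (cases "j = m")
          case True
          then have "real (Suc k) + 1 = real m" using Suc m0 by simp
          then have "real (Suc k) / real m + 1 / real m = 1"
            using m0 by (simp flip: add_divide_distrib)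
          then show ?thesis using Fx by simp
        next
          case False
          then have "j = Suc k" using Suc \<open>j \<le> m\<close> by auto
          then show ?thesis using jm(2) split[of "Suc k"] by simp
        qed
        moreover have "real (Suc k) / real m \<le> F t" using Q_le[OF p, of t] by (simp add: t_def)
        moreover have "t \<in> T" unfolding t_def using k by (intro in_T) auto
        ultimately show ?thesis using me by (intro disjI2 bexI[of _ t]) auto
      qed
      show "1 \<le> F x + e \<or> (\<exists>t\<in>T. x < t \<and> measure \<nu> {..<t} \<le> F x + e)"
      proof (cases "Suc j < m")
        case True
        define t where "t = Q (real (Suc j) / real m)"
        have p: "0 < real (Suc j) / real m" "real (Suc j) / real m < 1" using True by auto
        have "x < t" using Q_le[OF p, of x] jm by (simp add: t_def flip: not_le)
        moreover have "measure \<nu> {..<t} \<le> F x + e"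
          using Q_left[OF p] jm me split[of j] by (simp add: t_def)
        moreover have "t \<in> T" unfolding t_def using True by (intro in_T) auto
        ultimately show ?thesis by blast
      next
        case False
        then have "1 \<le> real (Suc j) / real m" using m0 by simp
        then show ?thesis using jm me split[of j] by linarith
      qed
    qed
  qed
  then show ?thesis by (intro exI[of _ T]) (auto simp: T_def F_def)
qed

text \<open>Frequencies are monotone in the set: at a point \<open>t \<le> x\<close> the frequency of \<open>{..t}\<close> is a lower bound for
that of \<open>{..x}\<close>, and at \<open>t > x\<close> the frequency of \<open>{..<t}\<close> is an upper bound. So convergence at
the finitely many bracketing points for \<open>e\<close> gives an error of at most \<open>2 * e\<close> for all \<open>x\<close>; letting \<open>e\<close>
run through a null sequence keeps the exceptional set a countable union of null sets.\<close>
lemma glivenko_cantelli_of_pointwise: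
  assumes "prob_space M" and "real_distribution \<nu>"
    and atMost: "\<And>x. AE \<omega> in M. (\<lambda>n. freq Xs {..x} n \<omega>) \<longlonglongrightarrow> cdf \<nu> x"
    and lessThan: "\<And>x. AE \<omega> in M. (\<lambda>n. freq Xs {..<x} n \<omega>) \<longlonglongrightarrow> measure \<nu> {..<x}"
  shows "AE \<omega> in M. (\<lambda>n. SUP x. \<bar>freq Xs {..x} n \<omega> - cdf \<nu> x\<bar>) \<longlonglongrightarrow> 0"
proof -
  interpret \<nu>: real_distribution \<nu> by fact
  define brackets where "brackets e T \<longleftrightarrow> finite T \<and> (\<forall>x.
      (cdf \<nu> x \<le> e \<or> (\<exists>t\<in>T. t \<le> x \<and> cdf \<nu> x \<le> cdf \<nu> t + e)) \<and>
      (1 \<le> cdf \<nu> x + e \<or> (\<exists>t\<in>T. x < t \<and> measure \<nu> {..<t} \<le> cdf \<nu> x + e)))" for e T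
  have "\<forall>m. \<exists>T. brackets (1 / real (Suc m)) T"
    unfolding brackets_def by (intro allI cdf_finite_bracketing assms) simp
  then obtain T where T: "\<And>m. brackets (1 / real (Suc m)) (T m)" by metis
  define D where "D = (\<Union>m. T m)"
  have D: "countable D"
    using T unfolding D_def brackets_def by (intro countable_UN) (auto intro: countable_finite)
  have "AE \<omega> in M. \<forall>t\<in>D. (\<lambda>n. freq Xs {..t} n \<omega>) \<longlonglongrightarrow> cdf \<nu> t"
    unfolding AE_ball_countable[OF D] using atMost by simp
  moreover have "AE \<omega> in M. \<forall>t\<in>D. (\<lambda>n. freq Xs {..<t} n \<omega>) \<longlonglongrightarrow> measure \<nu> {..<t}"
    unfolding AE_ball_countable[OF D] using lessThan by simp
  ultimately show ?thesis
  proof eventually_elim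
    case (elim \<omega>)
    define s where "s n = (SUP x. \<bar>freq Xs {..x} n \<omega> - cdf \<nu> x\<bar>)" for n
    have diff_le_1: "\<bar>freq Xs {..x} n \<omega> - cdf \<nu> x\<bar> \<le> 1" for x n
      using freq_nonneg[of Xs "{..x}" n \<omega>] freq_le_1[of Xs "{..x}" n \<omega>]
        \<nu>.cdf_nonneg[of x] \<nu>.cdf_bounded_prob[of x] by linarith
    have s_nonneg: "0 \<le> s n" for n
    proof -
      have "0 \<le> \<bar>freq Xs {..0} n \<omega> - cdf \<nu> 0\<bar>" by simp
      also have "\<dots> \<le> s n"
        unfolding s_def using diff_le_1 by (intro cSUP_upper bdd_aboveI2) auto
      finally show ?thesis .
    qed
    have "s \<longlonglongrightarrow> 0"
    proof (rule LIMSEQ_I)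
      fix r :: real assume "0 < r"
      then obtain m where m: "1 / real (Suc m) < r / 2"
        using nat_approx_posE[of "r / 2"] by auto
      define e where "e = 1 / real (Suc m)"
      have e: "0 < e" "2 * e < r" using m by (auto simp: e_def)
      have fin: "finite (T m)" and sub: "T m \<subseteq> D" using T[of m] by (auto simp: brackets_def D_def)
      have "\<forall>\<^sub>F n in sequentially. \<forall>t\<in>T m.
          cdf \<nu> t - e < freq Xs {..t} n \<omega> \<and> freq Xs {..<t} n \<omega> < measure \<nu> {..<t} + e"
        unfolding eventually_ball_finite_distrib[OF fin] eventually_conj_iff
        using elim sub e by (auto intro!: order_tendstoD)
      then have "\<forall>\<^sub>F n in sequentially. s n \<le> 2 * e"
      proof eventually_elim
        case (elim n)
        have "\<bar>freq Xs {..x} n \<omega> - cdf \<nu> x\<bar> \<le> 2 * e" for x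
        proof -
          have br: "cdf \<nu> x \<le> e \<or> (\<exists>t\<in>T m. t \<le> x \<and> cdf \<nu> x \<le> cdf \<nu> t + e)"
            "1 \<le> cdf \<nu> x + e \<or> (\<exists>t\<in>T m. x < t \<and> measure \<nu> {..<t} \<le> cdf \<nu> x + e)"
            using T[of m] by (auto simp: brackets_def e_def)
          have "cdf \<nu> x - 2 * e \<le> freq Xs {..x} n \<omega>"
            using br(1)
          proof (elim disjE bexE conjE)
            fix t assume "t \<in> T m" "t \<le> x" "cdf \<nu> x \<le> cdf \<nu> t + e"
            moreover have "freq Xs {..t} n \<omega> \<le> freq Xs {..x} n \<omega>"
              using \<open>t \<le> x\<close> by (intro freq_mono) auto
            ultimately show ?thesis using elim by force
          qed (use e freq_nonneg[of Xs "{..x}" n \<omega>] in linarith)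
          moreover have "freq Xs {..x} n \<omega> \<le> cdf \<nu> x + 2 * e"
            using br(2)
          proof (elim disjE bexE conjE)
            fix t assume "t \<in> T m" "x < t" "measure \<nu> {..<t} \<le> cdf \<nu> x + e"
            moreover have "freq Xs {..x} n \<omega> \<le> freq Xs {..<t} n \<omega>"
              using \<open>x < t\<close> by (intro freq_mono) auto
            ultimately show ?thesis using elim by force
          qed (use e freq_le_1[of Xs "{..x}" n \<omega>] in linarith)
          ultimately show ?thesis by linarith
        qed
        then show ?case unfolding s_def by (intro cSUP_least) auto
      qed
      then show "\<exists>no. \<forall>n\<ge>no. norm (s n - 0) < r"
        unfolding eventually_sequentially using s_nonneg e by (force simp: abs_of_nonneg)
    qed
    then show ?case by (simp only: s_def[abs_def])
  qed
qed

theorem theorem5: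
  fixes M :: "'a measure" and X :: "'a \<Rightarrow> real" and Xs :: "nat \<Rightarrow> 'a \<Rightarrow> real"
    and F :: "real \<Rightarrow> real" and \<delta> :: real
  assumes "prob_space M"
    and "X \<in> borel_measurable M"
    and "stationary_seq M Xs"
    and "\<And>i. i \<ge> 1 \<Longrightarrow> distr M borel (Xs i) = distr M borel X"
    and "integrable M (\<lambda>\<omega>. (X \<omega>)\<^sup>2)"
    and "\<And>i. i \<ge> 1 \<Longrightarrow> integrable M (\<lambda>\<omega>. (Xs i \<omega>)\<^sup>2)"
    and "F = cdf (distr M borel X)"
    and "0 < \<delta>" and "\<delta> < 3"
    and "\<And>x. (SUP q\<in>{1::nat..}.
           ereal (1 / real q powr ((3 - \<delta>) / 2) * var_cov_sum M Xs x {1..q})) < \<infinity>"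
    and "\<And>x. (SUP q\<in>{1::nat..}.
           ereal (1 / real q powr (3 - \<delta>) * var_cov_sum M Xs x {q\<^sup>2 + 1..(q + 1)\<^sup>2})) < \<infinity>"
  shows "AE \<omega> in M. (\<lambda>n. SUP x. \<bar>empirical_cdf Xs n \<omega> x - F x\<bar>) \<longlonglongrightarrow> 0"
proof -
  interpret prob_space M by fact
  define \<nu> where "\<nu> = distr M borel X"
  have rd: "real_distribution \<nu>"
    unfolding \<nu>_def by (rule real_distribution_distr) (fact assms(2))
  interpret \<nu>: real_distribution \<nu> by (fact rd)
  have meas: "Xs i \<in> borel_measurable M" if "1 \<le> i" for i
    using assms(3) that by (auto simp: stationary_seq_def)
  have law: "distr M borel (Xs i) = \<nu>" if "1 \<le> i" for i
    using assms(4)[OF that] by (simp add: \<nu>_def)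
  have mean: "(\<integral>\<omega>. indic_le (Xs i) x \<omega> \<partial>M) = cdf \<nu> x" if "1 \<le> i" for i x
  proof -
    have "(\<integral>\<omega>. indic_le (Xs i) x \<omega> \<partial>M) = (\<integral>\<omega>. indicator {..x} (Xs i \<omega>) \<partial>M)"
      by (simp add: indic_le_def indicator_def)
    also have "\<dots> = (\<integral>z. indicator {..x} z \<partial>\<nu>)"
      unfolding law[OF that, symmetric] using meas[OF that]
      by (intro integral_distr[symmetric]) auto
    also have "\<dots> = cdf \<nu> x" by (simp add: cdf_def)
    finally show ?thesis .
  qed
  have atMost: "AE \<omega> in M. (\<lambda>n. freq Xs {..x} n \<omega>) \<longlonglongrightarrow> cdf \<nu> x" for x
  proof -
    let ?f = "\<lambda>q::nat. 1 / real q powr ((3 - \<delta>) / 2) * var_cov_sum M Xs x {1..q}"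
    have "(SUP q\<in>{1::nat..}. ereal (?f q)) \<noteq> \<infinity>"
      using assms(10)[of x] by (rule less_imp_neq)
    then obtain N :: nat where "(SUP q\<in>{1::nat..}. ereal (?f q)) < ereal (real N)"
      unfolding less_PInf_Ex_of_nat by (rule exE)
    then have N: "(SUP q\<in>{1::nat..}. ereal (?f q)) \<le> ereal (real N)"
      by (rule less_imp_le)
    have "var_cov_sum M Xs x {1..q} \<le> real N * real q powr ((3 - \<delta>) / 2)" if "1 \<le> q" for q
    proof -
      have "ereal (?f q) \<le> (SUP q\<in>{1::nat..}. ereal (?f q))"
        using that by (intro SUP_upper) simp
      then have "ereal (?f q) \<le> ereal (real N)" using N by (rule order_trans)
      then have "?f q \<le> real N" by (simp only: ereal_less_eq)
      then show ?thesis using that by (simp add: pos_divide_le_eq)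
    qed
    then show ?thesis
      using assms(8) by (intro freq_atMost_AE_tendsto[OF assms(1) meas mean \<nu>.cdf_nonneg
          \<nu>.cdf_bounded_prob, where a = "(3 - \<delta>) / 2"]) simp_all
  qed
  have "AE \<omega> in M. (\<lambda>n. SUP x. \<bar>freq Xs {..x} n \<omega> - cdf \<nu> x\<bar>) \<longlonglongrightarrow> 0"
    by (intro glivenko_cantelli_of_pointwise assms(1) rd atMost
        freq_lessThan_AE_tendsto[OF assms(1,3) law]) simp
  then show ?thesis by (simp add: empirical_cdf_eq_freq assms(7) \<nu>_def)
qed

end
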